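(* Let $r \ge 3$. The question set $\overline{Q}_r$ does not admit exponential parallel repetition; that is, there is no constant $C<1$ such that $\omega_{\overline{Q}_r}(n) \le C^n$ for all $n\in\mathbb{N}$.
   Context: Games: an $r$-prover question set is a finite nonempty $\overline{Q}\subseteq Q^{(1)}\times\cdots\times Q^{(r)}$ with finite $Q^{(j)}$ such that every element of each $Q^{(j)}$ occurs as a $j$-th coordinate of some tuple of $\overline{Q}$. An $r$-prover game with question set $\overline{Q}$ is $(\overline{Q},\overline{A},V)$ with $\overline{A}=A^{(1)}\times\cdots\times A^{(r)}$ a product of finite alphabets and $V:\overline{Q}\times\overline{A}\to\{0,1\}$. A strategy is $(\mathcal{S}^{(1)},\dots,\mathcal{S}^{(r)})$, $\mathcal{S}^{(j)}:Q^{(j)}\to A^{(j)}$; the value is the maximum over strategies of the probability, over $\overline{q}$ uniform on $\overline{Q}$, that $V(\overline{q},\mathcal{S}^{(1)}(q^{(1)}),\dots,\mathcal{S}^{(r)}(q^{(r)}))=1$. A game is trivial if its value is $1$. The $n$-fold parallel repetition $\mathcal{G}^n$ has question set $\overline{Q}^n$ (prover $j$ gets the $n$ $j$-th coordinates), answer alphabets $(A^{(j)})^n$, and accepts iff $V$ accepts in all $n$ coordinates. $\omega_{\overline{Q}}(n)$ is the supremum of $\mathrm{val}(\mathcal{G}^n)$ over all non-trivial games with question set $\overline{Q}$. $\overline{Q}$ admits exponential parallel repetition if there is $C<1$ with $\omega_{\overline{Q}}(n)\le C^n$ for every $n$. $\overline{Q}_r$: $Q^{(j)}=\{0,1\}$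 for all $j$, and $\overline{Q}_r=\{(q^{(1)},\dots,q^{(r)})\in\{0,1\}^r: \text{exactly one } q^{(j)} \text{ equals } 1\}$. *)

theory Defs
  imports "HOL-Probability.Probability_Mass_Function" "HOL-Library.FuncSet"
begin

text \<open>
  Provers are indexed by \<open>0, \<dots>, r - 1\<close> and rounds by \<open>0, \<dots>, n - 1\<close>. All tuples are extensional
  functions (\<open>undefined\<close> outside the index range), so that \<open>Pi\<^sub>E {..<r} Q\<close> is the Cartesian product
  of the sets \<open>Q 0, \<dots>, Q (r - 1)\<close>.
\<close>

definition question_set :: "nat \<Rightarrow> (nat \<Rightarrow> 'q set) \<Rightarrow> (nat \<Rightarrow> 'q) set \<Rightarrow> bool" where
  "question_set r Q Qbar \<longleftrightarrow>
     (\<forall>j<r. finite (Q j)) \<and> Qbar \<noteq> {} \<and> Qbar \<subseteq> Pi\<^sub>E {..<r} Q \<and>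
     (\<forall>j<r. \<forall>x\<in>Q j. \<exists>q\<in>Qbar. q j = x)"

record ('q, 'a) game =
  provers :: nat
  question_alphabet :: "nat \<Rightarrow> 'q set"
  questions :: "(nat \<Rightarrow> 'q) set"
  answer_alphabet :: "nat \<Rightarrow> 'a set"
  accepts :: "(nat \<Rightarrow> 'q) \<Rightarrow> (nat \<Rightarrow> 'a) \<Rightarrow> bool"

text \<open>
  Answer alphabets are required to be nonempty: otherwise there is no strategy and the value, a
  maximum over strategies, does not exist. The values of \<open>accepts\<close> outside the product of questions
  and answers are irrelevant, as \<open>game_value\<close> never looks at them.
\<close>

definition is_game :: "('q, 'a) game \<Rightarrow> bool" where
  "is_game G \<longleftrightarrow>
     question_set (provers G) (question_alphabet G) (questions G) \<and>
     (\<forall>j<provers G. finite (answer_alphabet G j) \<and> answer_alphabet G j \<noteq> {})"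

definition strategies :: "('q, 'a) game \<Rightarrow> (nat \<Rightarrow> 'q \<Rightarrow> 'a) set" where
  "strategies G =
     (\<Pi>\<^sub>E j\<in>{..<provers G}. question_alphabet G j \<rightarrow>\<^sub>E answer_alphabet G j)"

definition success_prob :: "('q, 'a) game \<Rightarrow> (nat \<Rightarrow> 'q \<Rightarrow> 'a) \<Rightarrow> real" where
  "success_prob G S =
     measure_pmf.prob (pmf_of_set (questions G))
       {q. accepts G q (\<lambda>j\<in>{..<provers G}. S j (q j))}"

definition game_value :: "('q, 'a) game \<Rightarrow> real" where
  "game_value G = Max (success_prob G ` strategies G)"

definition trivial_game :: "('q, 'a) game \<Rightarrow> bool" where
  "trivial_game G \<longleftrightarrow> game_value G = 1"

text \<open>
  In \<open>repetition n G\<close> the question to prover \<open>j\<close> is itself an \<open>n\<close>-tuple: \<open>q j i\<close> is what prover \<open>j\<close>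
  is asked in round \<open>i\<close>, so \<open>\<lambda>j\<in>{..<provers G}. q j i\<close> is the question tuple of round \<open>i\<close>.
\<close>

definition repetition :: "nat \<Rightarrow> ('q, 'a) game \<Rightarrow> (nat \<Rightarrow> 'q, nat \<Rightarrow> 'a) game" where
  "repetition n G =
     \<lparr> provers = provers G,
       question_alphabet = (\<lambda>j. {..<n} \<rightarrow>\<^sub>E question_alphabet G j),
       questions =
         {q \<in> (\<Pi>\<^sub>E j\<in>{..<provers G}. {..<n} \<rightarrow>\<^sub>E question_alphabet G j).
            \<forall>i<n. (\<lambda>j\<in>{..<provers G}. q j i) \<in> questions G},
       answer_alphabet = (\<lambda>j. {..<n} \<rightarrow>\<^sub>E answer_alphabet G j),
       accepts =
         (\<lambda>q a. \<forall>i<n. accepts G (\<lambda>j\<in>{..<provers G}. q j i) (\<lambda>j\<in>{..<provers G}. a j i)) \<rparr>"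

text \<open>
  Quantifying over games whose answers are natural numbers loses nothing: every finite alphabet can
  be renamed to a set of natural numbers, and renaming answers preserves all values. The set below
  is bounded by \<open>1\<close>, and nonempty because of the game that never accepts.
\<close>

definition omega :: "nat \<Rightarrow> (nat \<Rightarrow> 'q set) \<Rightarrow> (nat \<Rightarrow> 'q) set \<Rightarrow> nat \<Rightarrow> real" where
  "omega r Q Qbar n =
     Sup {game_value (repetition n G) | G :: ('q, nat) game.
            is_game G \<and> provers G = r \<and> question_alphabet G = Q \<and> questions G = Qbar \<and>
            \<not> trivial_game G}"

definition admits_exponential_parallel_repetition ::
    "nat \<Rightarrow> (nat \<Rightarrow> 'q set) \<Rightarrow> (nat \<Rightarrow> 'q) set \<Rightarrow> bool" where
  "admits_exponential_parallel_repetition r Q Qbar \<longleftrightarrow>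
     (\<exists>C::real. C < 1 \<and> (\<forall>n. omega r Q Qbar n \<le> C ^ n))"

definition binary_alphabets :: "nat \<Rightarrow> nat set" where
  "binary_alphabets j = {0, 1}"

definition one_hot_questions :: "nat \<Rightarrow> (nat \<Rightarrow> nat) set" where
  "one_hot_questions r = {q \<in> Pi\<^sub>E {..<r} binary_alphabets. \<exists>!j. j < r \<and> q j = 1}"

end

theory Submission
  imports Defs "HOL-Real_Asymp.Real_Asymp"
begin

text \<open>
  A tuple of \<open>n\<close> questions from the one-hot question set is a word \<open>w \<in> {..<r}\<^sup>n\<close>: letter \<open>w k\<close> is
  the prover who receives \<open>1\<close> in round \<open>k\<close>. For a set \<open>S\<close> of words consider the game in which each
  prover answers with a round \<open>i\<close> and an \<open>n\<close>-bit vector, and the verifier accepts iff all provers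
  name the same \<open>i\<close>, the vectors are the views of some \<open>w \<in> S\<close>, and the question asked is \<open>w i\<close>.
  In the \<open>n\<close>-fold repetition the provers can answer truthfully in each round and win whenever the
  question word lies in \<open>S\<close>, while a perfect strategy for a single copy amounts to a combinatorial
  line contained in \<open>S\<close>. Words with prescribed letter counts contain no line, and by pigeonhole some
  choice of counts gives a set of density at least \<open>1 / (n + 1)\<^sup>r\<close>, which is not exponentially small.
\<close>

section \<open>Line-free sets of words\<close>

text \<open>Combinatorial lines as in the Hales-Jewett theorem: \<open>I\<close> is the set of
  active coordinates, \<open>f\<close> gives the fixed letters.\<close>

definition line_free :: "nat \<Rightarrow> nat \<Rightarrow> (nat \<Rightarrow> nat) set \<Rightarrow> bool" where
  "line_free r n S \<longleftrightarrow>
     \<not> (\<exists>I f. I \<noteq> {} \<and> I \<subseteq> {..<n} \<and>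
          (\<forall>a<r. (\<lambda>k\<in>{..<n}. if k \<in> I then a else f k) \<in> S))"

text \<open>Restricted to the alphabet so that the profiles lie in a finite function space, as the
  pigeonhole argument requires.\<close>

definition letter_counts :: "nat \<Rightarrow> nat \<Rightarrow> (nat \<Rightarrow> nat) \<Rightarrow> nat \<Rightarrow> nat" where
  "letter_counts r n w = (\<lambda>a\<in>{..<r}. card {k\<in>{..<n}. w k = a})"

text \<open>Passing from the point with letter 0 to the point with letter 1 turns every active
  coordinate from 0 to 1, so the number of zeros strictly drops along a line.\<close>

lemma line_free_letter_counts:
  assumes "r \<ge> 2"
  shows "line_free r n {w \<in> {..<n} \<rightarrow>\<^sub>E {..<r}. letter_counts r n w = c}"
  unfolding line_free_def
proof clarify
  fix I f
  assume I: "I \<noteq> {}" "I \<subseteq> {..<n}"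
    and line: "\<forall>a<r. (\<lambda>k\<in>{..<n}. if k \<in> I then a else f k)
                 \<in> {w \<in> {..<n} \<rightarrow>\<^sub>E {..<r}. letter_counts r n w = c}"
  define L where "L a = (\<lambda>k\<in>{..<n}. if k \<in> I then a else f k)" for a :: nat
  have "letter_counts r n (L 0) 0 = letter_counts r n (L 1) 0"
    using line assms by (simp add: L_def)
  then have "card {k\<in>{..<n}. L 0 k = 0} = card {k\<in>{..<n}. L 1 k = 0}"
    using assms by (simp add: letter_counts_def)
  moreover have "{k\<in>{..<n}. L 1 k = 0} \<subset> {k\<in>{..<n}. L 0 k = 0}"
    using I by (auto simp: L_def)
  then have "card {k\<in>{..<n}. L 1 k = 0} < card {k\<in>{..<n}. L 0 k = 0}"
    by (intro psubset_card_mono) auto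
  ultimately show False by simp
qed

lemma exists_dense_line_free:
  assumes "r \<ge> 2"
  obtains S where "S \<subseteq> {..<n} \<rightarrow>\<^sub>E {..<r}" "line_free r n S" "r ^ n \<le> (n + 1) ^ r * card S"
proof -
  define W where "W = {..<n} \<rightarrow>\<^sub>E {..<r}"
  define T where "T = {..<r} \<rightarrow>\<^sub>E {..n}"
  define F where "F c = {w \<in> W. letter_counts r n w = c}" for c
  have fin: "finite W" "finite T"
    unfolding W_def T_def by (auto intro!: finite_PiE)
  have cards: "card W = r ^ n" "card T = (n + 1) ^ r"
    unfolding W_def T_def by (simp_all add: card_PiE)
  have maps: "letter_counts r n w \<in> T" for w
    unfolding letter_counts_def T_def
    by (auto intro: order.trans[OF card_mono[of "{..<n}"]])
  then have "W = (\<Union>c\<in>T. F c)" by (auto simp: F_def)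
  also have "card \<dots> = (\<Sum>c\<in>T. card (F c))"
    using fin by (intro card_UN_disjoint) (auto simp: F_def)
  finally have sum: "card W = (\<Sum>c\<in>T. card (F c))" .
  \<comment> \<open>Averaging: if every class had fewer than \<open>card W / card T\<close> words,
    the classes could not add up to \<open>W\<close>.\<close>
  have "\<exists>c. card W \<le> card T * card (F c)"
  proof (rule ccontr)
    assume "\<not> ?thesis"
    then have small: "card T * card (F c) < card W" for c by (simp add: not_le)
    have "T \<noteq> {}" using maps by blast
    then have "(\<Sum>c\<in>T. card T * card (F c)) < (\<Sum>c\<in>T. card W)"
      using fin small by (intro sum_strict_mono) auto
    then show False using sum by (simp flip: sum_distrib_left)
  qed
  then obtain c where "card W \<le> card T * card (F c)" by blast
  moreover have "line_free r n (F c)"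
    using line_free_letter_counts[OF assms] by (simp add: F_def W_def)
  ultimately show thesis
    using that[of "F c"] cards by (auto simp: F_def W_def)
qed

section \<open>The one-hot question set\<close>

definition one_hot :: "nat \<Rightarrow> nat \<Rightarrow> nat \<Rightarrow> nat" where
  "one_hot r a = (\<lambda>j\<in>{..<r}. of_bool (a = j))"

lemma one_hot_questions_eq: "one_hot_questions r = one_hot r ` {..<r}"
proof (intro equalityI subsetI)
  fix q assume "q \<in> one_hot_questions r"
  then have q: "q \<in> Pi\<^sub>E {..<r} binary_alphabets" and "\<exists>!j. j < r \<and> q j = 1"
    by (auto simp: one_hot_questions_def)
  then obtain a where a: "a < r" "q a = 1" "\<And>j. j < r \<Longrightarrow> q j = 1 \<Longrightarrow> j = a" by blast
  have "q j = one_hot r a j" for j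
  proof (cases "j < r")
    case True
    then have "q j \<in> {0, 1}" using q by (auto simp: binary_alphabets_def PiE_iff)
    moreover have "q j = 1 \<longleftrightarrow> a = j" using True a by blast
    ultimately show ?thesis using True by (auto simp: one_hot_def)
  next
    case False
    then show ?thesis using q by (auto simp: one_hot_def PiE_iff extensional_def)
  qed
  with a show "q \<in> one_hot r ` {..<r}" by blast
next
  fix q assume "q \<in> one_hot r ` {..<r}"
  then obtain a where a: "a < r" "q = one_hot r a" by blast
  have "\<exists>!j. j < r \<and> q j = 1"
    using a by (intro ex1I[of _ a]) (auto simp: one_hot_def simp del: One_nat_def)
  then show "q \<in> one_hot_questions r"
    using a(2) by (auto simp: one_hot_def one_hot_questions_def binary_alphabets_def)
qed

lemma question_set_one_hot:
  assumes "r \<ge> 2"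
  shows "question_set r binary_alphabets (one_hot_questions r)"
proof -
  have "\<exists>q\<in>one_hot_questions r. q j = x" if "j < r" "x \<in> binary_alphabets j" for j x
  proof -
    \<comment> \<open>Prover \<open>j\<close> is asked 0 exactly when another prover
      \<open>b\<close> receives the 1.\<close>
    obtain b where b: "b < r" "b \<noteq> j"
      using assms that[of "if j = 0 then 1 else 0"] by (simp split: if_splits)
    have "one_hot r j j = 1" "one_hot r b j = 0"
      using that b by (auto simp: one_hot_def)
    then show ?thesis
      using that b by (auto simp: one_hot_questions_eq binary_alphabets_def)
  qed
  moreover have "one_hot_questions r \<noteq> {}"
    using assms by (auto simp: one_hot_questions_eq lessThan_empty_iff)
  moreover have "one_hot_questions r \<subseteq> Pi\<^sub>E {..<r} binary_alphabets"
    by (auto simp: one_hot_questions_def)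
  ultimately show ?thesis by (auto simp: question_set_def binary_alphabets_def)
qed

section \<open>Values and repetitions of general games\<close>

lemma finite_strategies: "is_game G \<Longrightarrow> finite (strategies G)"
  by (auto simp: is_game_def question_set_def strategies_def intro!: finite_PiE)

lemma strategies_nonempty: "is_game G \<Longrightarrow> strategies G \<noteq> {}"
  by (auto simp: is_game_def strategies_def PiE_eq_empty_iff)

lemma success_prob_le_game_value:
  "is_game G \<Longrightarrow> s \<in> strategies G \<Longrightarrow> success_prob G s \<le> game_value G"
  by (auto simp: game_value_def intro!: Max_ge finite_strategies)

lemma game_value_attained:
  assumes "is_game G"
  obtains s where "s \<in> strategies G" "game_value G = success_prob G s"
proof -
  have "game_value G \<in> success_prob G ` strategies G"
    unfolding game_value_def
    using assms by (intro Max_in) (auto simp: finite_strategies strategies_nonempty)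
  then show thesis using that by blast
qed

lemma game_value_le_1: "is_game G \<Longrightarrow> game_value G \<le> 1"
  by (metis game_value_attained measure_pmf.prob_le_1 success_prob_def)

lemma is_game_repetition:
  assumes G: "is_game G"
  shows "is_game (repetition n G)"
proof -
  define P where "P = {..<provers G}"
  have fin: "finite (question_alphabet G j)" if "j \<in> P" for j
    using G that by (auto simp: is_game_def question_set_def P_def)
  have sub: "questions G \<subseteq> Pi\<^sub>E P (question_alphabet G)" and ne: "questions G \<noteq> {}"
    using G by (auto simp: is_game_def question_set_def P_def)
  have cover: "\<exists>q\<in>questions G. q j = x" if "j \<in> P" "x \<in> question_alphabet G j" for j x
    using G that by (auto simp: is_game_def question_set_def P_def)
  \<comment> \<open>Transposition: tuples chosen round by round are regrouped by prover. Choosing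
    each tuple with a given \<open>j\<close>-th coordinate later shows that every question of the
    repetition occurs.\<close>
  have combine: "(\<lambda>j\<in>P. \<lambda>i\<in>{..<n}. p i j) \<in> questions (repetition n G)"
    if p: "\<And>i. i < n \<Longrightarrow> p i \<in> questions G" for p
  proof -
    have "(\<lambda>j\<in>P. (\<lambda>j\<in>P. \<lambda>i\<in>{..<n}. p i j) j i) = p i" if "i < n" for i
      using subsetD[OF sub p[OF that]] that by (auto simp: fun_eq_iff PiE_iff extensional_def)
    then show ?thesis
      using subsetD[OF sub p] p by (auto simp: repetition_def P_def[symmetric] PiE_iff)
  qed
  have "questions (repetition n G) \<noteq> {}"
  proof -
    obtain q where "q \<in> questions G" using ne by blast
    then show ?thesis using combine[of "\<lambda>_. q"] by blast
  qed
  moreover have "\<exists>q\<in>questions (repetition n G). q j = x"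
    if j: "j \<in> P" and x: "x \<in> {..<n} \<rightarrow>\<^sub>E question_alphabet G j" for j x
  proof -
    have "\<forall>i\<in>{..<n}. \<exists>q\<in>questions G. q j = x i"
      using cover[OF j] x by blast
    then obtain p where "\<And>i. i < n \<Longrightarrow> p i \<in> questions G \<and> p i j = x i"
      by (metis lessThan_iff)
    then show ?thesis
      using x j by (intro bexI[OF _ combine[of p]]) (auto simp: fun_eq_iff PiE_iff extensional_def)
  qed
  moreover have "questions (repetition n G) \<subseteq> (\<Pi>\<^sub>E j\<in>P. {..<n} \<rightarrow>\<^sub>E question_alphabet G j)"
    by (auto simp: repetition_def P_def)
  ultimately have "question_set (provers G) (\<lambda>j. {..<n} \<rightarrow>\<^sub>E question_alphabet G j)
      (questions (repetition n G))"
    using fin by (auto simp: question_set_def P_def intro!: finite_PiE)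
  then show ?thesis
    using G by (auto simp: is_game_def repetition_def PiE_eq_empty_iff intro!: finite_PiE)
qed

text \<open>The maximum is attained, and the uniform distribution on a finite set charges each
  question, so probability 1 means acceptance everywhere.\<close>

lemma game_value_eq_1D:
  assumes G: "is_game G" and "game_value G = 1"
  obtains s where "s \<in> strategies G"
    "\<And>q. q \<in> questions G \<Longrightarrow> accepts G q (\<lambda>j\<in>{..<provers G}. s j (q j))"
proof -
  have Q: "finite (questions G)" "questions G \<noteq> {}"
    using G by (auto simp: is_game_def question_set_def intro!: finite_PiE elim!: finite_subset)
  obtain s where s: "s \<in> strategies G" and "success_prob G s = 1"
    using game_value_attained[OF G] assms(2) by metis
  then have "AE q in measure_pmf (pmf_of_set (questions G)).
      q \<in> {q. accepts G q (\<lambda>j\<in>{..<provers G}. s j (q j))}"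
    by (intro measure_pmf.AE_prob_1) (simp add: success_prob_def)
  then show thesis
    using that[OF s] Q by (auto simp: AE_measure_pmf_iff)
qed

section \<open>The line game is not trivial\<close>

text \<open>\<open>omega\<close> ranges over games with natural-number answers, so pairs of a round
  and a bit vector are coded injectively; listing \<open>x\<close> on \<open>[0..<n]\<close>
  discards its values beyond \<open>n\<close>.\<close>

definition encode_view :: "nat \<Rightarrow> nat \<Rightarrow> (nat \<Rightarrow> nat) \<Rightarrow> nat" where
  "encode_view n i x = to_nat (i, map x [0..<n])"

lemma encode_view_eq_iff:
  "encode_view n i x = encode_view n i' x' \<longleftrightarrow> i = i' \<and> (\<forall>k<n. x k = x' k)"
  by (auto simp: encode_view_def)

text \<open>This is a one-round game: \<open>n\<close> is a word length and \<open>i\<close> a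
  position in the word. They acquire their meaning as rounds only once the game is repeated
  \<open>n\<close> times.\<close>

definition line_game :: "nat \<Rightarrow> nat \<Rightarrow> (nat \<Rightarrow> nat) set \<Rightarrow> (nat, nat) game" where
  "line_game r n S =
     \<lparr> provers = r,
       question_alphabet = binary_alphabets,
       questions = one_hot_questions r,
       answer_alphabet = (\<lambda>j. (\<lambda>(i, x). encode_view n i x) ` ({..<n} \<times> ({..<n} \<rightarrow>\<^sub>E {0, 1}))),
       accepts = (\<lambda>q a. \<exists>i<n. \<exists>w\<in>S. \<forall>j<r.
         a j = encode_view n i (\<lambda>k. of_bool (w k = j)) \<and> q j = of_bool (w i = j)) \<rparr>"

lemma line_game_simps [simp]:
  "provers (line_game r n S) = r"
  "question_alphabet (line_game r n S) = binary_alphabets"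
  "questions (line_game r n S) = one_hot_questions r"
  by (simp_all add: line_game_def)

lemma is_game_line_game:
  assumes "r \<ge> 2" "n > 0"
  shows "is_game (line_game r n S)"
  using assms question_set_one_hot[OF assms(1)]
  by (auto simp: is_game_def line_game_def PiE_eq_empty_iff intro!: finite_PiE)

text \<open>A perfect strategy yields for each letter \<open>a\<close> a word \<open>w a\<close> in
  \<open>S\<close> with \<open>a\<close> at position \<open>i a\<close>. Provers who cannot tell the
  questions apart force each coordinate of \<open>w a\<close> either to equal \<open>a\<close> for
  all \<open>a\<close> or to be independent of \<open>a\<close>; so the words \<open>w a\<close>
  form a line.\<close>

lemma not_trivial_line_game:
  assumes r: "r \<ge> 3" and n: "n > 0" and S: "S \<subseteq> {..<n} \<rightarrow>\<^sub>E {..<r}" and free: "line_free r n S"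
  shows "\<not> trivial_game (line_game r n S)"
proof
  assume "trivial_game (line_game r n S)"
  then have val: "game_value (line_game r n S) = 1"
    by (simp add: trivial_game_def)
  have game: "is_game (line_game r n S)"
    using r n by (intro is_game_line_game) auto
  obtain s where s: "\<And>q. q \<in> one_hot_questions r \<Longrightarrow>
      accepts (line_game r n S) q (\<lambda>j\<in>{..<r}. s j (q j))"
    using game_value_eq_1D[OF game val] by auto
  define P where "P a i w \<longleftrightarrow> i < n \<and> w \<in> S \<and> (\<forall>j<r. s j (of_bool (a = j)) =
      encode_view n i (\<lambda>k. of_bool (w k = j)) \<and> (a = j \<longleftrightarrow> w i = j))" for a i w
  have "\<exists>i w. P a i w" if "a < r" for a
  proof -
    have "one_hot r a \<in> one_hot_questions r"
      using that by (simp add: one_hot_questions_eq)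
    from s[OF this] obtain i w where "i < n" "w \<in> S"
      and *: "\<forall>j<r. (\<lambda>j\<in>{..<r}. s j (one_hot r a j)) j = encode_view n i (\<lambda>k. of_bool (w k = j)) \<and>
        one_hot r a j = of_bool (w i = j)"
      unfolding line_game_def game.simps by blast
    moreover have "s j (of_bool (a = j)) = encode_view n i (\<lambda>k. of_bool (w k = j)) \<and> (a = j \<longleftrightarrow> w i = j)"
      if "j < r" for j
      using spec[OF *, of j] that by (auto simp: one_hot_def of_bool_eq_iff)
    ultimately show ?thesis unfolding P_def by blast
  qed
  then obtain i w where "\<And>a. a < r \<Longrightarrow> P a (i a) (w a)" by metis
  then have i: "\<And>a. a < r \<Longrightarrow> i a < n" and w: "\<And>a. a < r \<Longrightarrow> w a \<in> S"
    and ans: "\<And>a j. a < r \<Longrightarrow> j < r \<Longrightarrow>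
      s j (of_bool (a = j)) = encode_view n (i a) (\<lambda>k. of_bool (w a k = j))"
    and wi: "\<And>a j. a < r \<Longrightarrow> j < r \<Longrightarrow> a = j \<longleftrightarrow> w a (i a) = j"
    unfolding P_def by blast+
  txt \<open>A prover \<open>j\<close> other than \<open>a\<close> and \<open>b\<close> is asked \<open>0\<close> in both questions, hence cannot tell them apart;
    by \<open>r \<ge> 3\<close> there is such a prover for all \<open>a\<close> and \<open>b\<close>.\<close>
  have agree: "i a = i b \<and> (\<forall>k<n. w a k = j \<longleftrightarrow> w b k = j)"
    if "a < r" "b < r" "j < r" "a \<noteq> j" "b \<noteq> j" for a b j
  proof -
    have "encode_view n (i a) (\<lambda>k. of_bool (w a k = j)) = encode_view n (i b) (\<lambda>k. of_bool (w b k = j))"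
      using ans[of a j] ans[of b j] that by simp
    then show ?thesis by (simp add: encode_view_eq_iff of_bool_eq_iff)
  qed
  have third: "\<exists>j<r. j \<noteq> a \<and> j \<noteq> b" for a b
  proof -
    have "\<exists>j\<in>{0, 1, 2}. j \<noteq> a \<and> j \<noteq> b" by auto
    then show ?thesis using r by force
  qed
  have range: "w a k < r" if "a < r" "k < n" for a k
    using w[OF that(1)] S that by auto
  \<comment> \<open>Suppose \<open>w b k = c\<close> with \<open>c\<close> distinct from
    \<open>b\<close>. Prover \<open>c\<close> is asked 0 for every letter other than
    \<open>c\<close>, which spreads the value \<open>c\<close> to all words except
    \<open>w c\<close>. If \<open>w c k\<close> were another letter, the prover with that index
    would spread it to some third word, a contradiction.\<close>
  have const: "w a k = w 0 k" if "a < r" "k < n" and b: "b < r" "w b k \<noteq> b" for a b k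
  proof -
    define c where "c = w b k"
    have c: "c < r" "c \<noteq> b" using range that by (auto simp: c_def)
    have off: "w d k = c" if "d < r" "d \<noteq> c" for d
      using agree[of b d c] that b c \<open>k < n\<close> by (auto simp: c_def)
    have on: "w c k = c"
    proof (rule ccontr)
      assume ne: "w c k \<noteq> c"
      obtain d where d: "d < r" "d \<noteq> c" "d \<noteq> w c k" using third by metis
      have "w d k = w c k"
        using agree[of c d "w c k"] d c ne range \<open>k < n\<close> by auto
      then show False using off[OF d(1,2)] ne by simp
    qed
    have "w d k = c" if "d < r" for d using off on that by metis
    then show ?thesis using \<open>a < r\<close> r by auto
  qed
  define I where "I = {k\<in>{..<n}. \<forall>a<r. w a k = a}"
  \<comment> \<open>The named position is common to all questions, and the verifier's check puts
    \<open>a\<close> there in \<open>w a\<close>; hence the active set is nonempty.\<close>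
  have "i 0 \<in> I"
  proof -
    have "w a (i 0) = a" if a: "a < r" for a
    proof -
      obtain j where "j < r" "j \<noteq> a" "j \<noteq> 0" using third by blast
      then have "i a = i 0" using agree[of a 0 j] a r by auto
      then show ?thesis using wi[OF a a] by simp
    qed
    then show ?thesis using i[of 0] r by (simp add: I_def)
  qed
  \<comment> \<open>Off \<open>I\<close> some \<open>b\<close> has \<open>w b k\<close> different
    from \<open>b\<close>, so \<open>const\<close> applies and \<open>w 0\<close> supplies the fixed
    letters.\<close>
  moreover have "(\<lambda>k\<in>{..<n}. if k \<in> I then a else w 0 k) = w a" if "a < r" for a
  proof
    fix k
    show "(\<lambda>k\<in>{..<n}. if k \<in> I then a else w 0 k) k = w a k"
    proof (cases "k < n")
      case True
      then show ?thesis using const[OF that True] that by (auto simp: I_def)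
    next
      case False
      then show ?thesis using w[OF that] S by (auto simp: PiE_iff extensional_def)
    qed
  qed
  then have "\<forall>a<r. (\<lambda>k\<in>{..<n}. if k \<in> I then a else w 0 k) \<in> S"
    using w by simp
  moreover have "I \<subseteq> {..<n}" by (auto simp: I_def)
  ultimately show False
    using free unfolding line_free_def by blast
qed

section \<open>The value of the repeated line game\<close>

definition views :: "nat \<Rightarrow> nat \<Rightarrow> (nat \<Rightarrow> nat) \<Rightarrow> nat \<Rightarrow> nat \<Rightarrow> nat" where
  "views r n w = (\<lambda>j\<in>{..<r}. \<lambda>k\<in>{..<n}. of_bool (w k = j))"

text \<open>The letter \<open>w k\<close> is recovered as the prover who sees a 1 in round
  \<open>k\<close>.\<close>

lemma inj_on_views: "inj_on (views r n) ({..<n} \<rightarrow>\<^sub>E {..<r})"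
proof (rule inj_onI)
  fix v w assume v: "v \<in> {..<n} \<rightarrow>\<^sub>E {..<r}" and w: "w \<in> {..<n} \<rightarrow>\<^sub>E {..<r}"
    and eq: "views r n v = views r n w"
  show "v = w"
  proof (rule PiE_ext[OF v w])
    fix k assume k: "k \<in> {..<n}"
    then have "v k < r" using v by auto
    then show "v k = w k"
      using k fun_cong[OF fun_cong[OF eq, of "v k"], of k] by (simp add: views_def del: One_nat_def)
  qed
qed

lemma questions_repetition_line_game:
  "questions (repetition n (line_game r m S)) = views r n ` ({..<n} \<rightarrow>\<^sub>E {..<r})"
proof (intro equalityI subsetI)
  fix q assume "q \<in> questions (repetition n (line_game r m S))"
  then have q: "q \<in> (\<Pi>\<^sub>E j\<in>{..<r}. {..<n} \<rightarrow>\<^sub>E binary_alphabets j)"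
    and "\<forall>i<n. \<exists>a<r. (\<lambda>j\<in>{..<r}. q j i) = one_hot r a"
    by (auto simp: repetition_def one_hot_questions_eq)
  then obtain w where w: "\<And>i. i < n \<Longrightarrow> w i < r \<and> (\<lambda>j\<in>{..<r}. q j i) = one_hot r (w i)"
    by metis
  have "q j i = of_bool (w i = j)" if "j < r" "i < n" for i j
    using w[OF that(2)] that by (auto simp: one_hot_def dest!: fun_cong[of _ _ j])
  then have "q = views r n (restrict w {..<n})"
    using q by (fastforce simp: fun_eq_iff views_def PiE_iff extensional_def)
  then show "q \<in> views r n ` ({..<n} \<rightarrow>\<^sub>E {..<r})"
    using w by auto
next
  fix q assume "q \<in> views r n ` ({..<n} \<rightarrow>\<^sub>E {..<r})"
  then obtain w where w: "w \<in> {..<n} \<rightarrow>\<^sub>E {..<r}" and q: "q = views r n w" by blast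
  have "(\<lambda>j\<in>{..<r}. q j i) = one_hot r (w i)" if "i < n" for i
    using that by (auto simp: q views_def one_hot_def fun_eq_iff)
  then show "q \<in> questions (repetition n (line_game r m S))"
    using w by (auto simp: repetition_def one_hot_questions_eq q views_def binary_alphabets_def)
qed

text \<open>With as many repetitions as letters, the whole question of prover \<open>j\<close> is
  its view of the question word, so it can be given as the answer. If the word lies in
  \<open>S\<close>, it witnesses acceptance in all rounds at once.\<close>

lemma game_value_repetition_line_game:
  assumes r: "r \<ge> 2" and n: "n > 0" and S: "S \<subseteq> {..<n} \<rightarrow>\<^sub>E {..<r}"
  shows "real (card S) / real r ^ n \<le> game_value (repetition n (line_game r n S))"
proof -
  define G where "G = repetition n (line_game r n S)"
  \<comment> \<open>The truthful strategy: in round \<open>i\<close>, report \<open>i\<close> and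
    the full tuple \<open>x\<close> of received questions.\<close>
  define s where "s = (\<lambda>j\<in>{..<r}. \<lambda>x\<in>{..<n} \<rightarrow>\<^sub>E {0, 1}. \<lambda>i\<in>{..<n}. encode_view n i x)"
  define acc where "acc = {q. accepts G q (\<lambda>j\<in>{..<provers G}. s j (q j))}"
  have G: "is_game G"
    using r n by (auto simp: G_def intro!: is_game_repetition is_game_line_game)
  have "encode_view n i x \<in> answer_alphabet (line_game r n S) j"
    if "i < n" "x \<in> {..<n} \<rightarrow>\<^sub>E {0, 1}" for i j x
    using that unfolding line_game_def game.simps by (intro image_eqI[of _ _ "(i, x)"]) simp_all
  then have "s \<in> strategies G"
    unfolding strategies_def G_def repetition_def game.simps s_def line_game_simps binary_alphabets_def
    by (intro restrict_PiE_iff[THEN iffD2] ballI) simp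
  then have le: "success_prob G s \<le> game_value G"
    using G by (intro success_prob_le_game_value)
  have Q: "questions G = views r n ` ({..<n} \<rightarrow>\<^sub>E {..<r})"
    by (simp add: G_def questions_repetition_line_game)
  have finQ: "finite (questions G)"
    by (auto simp: Q intro!: finite_PiE)
  have cardQ: "card (questions G) = r ^ n"
    by (simp add: Q card_image[OF inj_on_views] card_PiE)
  have neQ: "questions G \<noteq> {}"
    using G by (auto simp: is_game_def question_set_def)
  have "views r n w \<in> acc" if w: "w \<in> S" for w
  proof -
    have "s j (views r n w j) i = encode_view n i (\<lambda>k. of_bool (w k = j))"
      if "j < r" "i < n" for i j
      using that by (auto simp: s_def views_def encode_view_eq_iff)
    moreover have "views r n w j i = of_bool (w i = j)" if "j < r" "i < n" for i j
      using that by (simp add: views_def)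
    ultimately have "accepts (line_game r n S) (\<lambda>j\<in>{..<r}. views r n w j i)
        (\<lambda>j\<in>{..<r}. (\<lambda>j\<in>{..<r}. s j (views r n w j)) j i)" if "i < n" for i
      using that unfolding line_game_def game.simps
      by (intro exI[of _ i] conjI bexI[OF _ w]) simp_all
    then show ?thesis
      by (simp add: acc_def G_def repetition_def)
  qed
  then have "views r n ` S \<subseteq> questions G \<inter> acc"
    using S by (auto simp: Q)
  then have "card (views r n ` S) \<le> card (questions G \<inter> acc)"
    using finQ by (intro card_mono) auto
  then have "card S \<le> card (questions G \<inter> acc)"
    using card_image[OF inj_on_subset[OF inj_on_views S]] by simp
  then have "real (card S) / real r ^ n \<le> success_prob G s"
    unfolding success_prob_def acc_def[symmetric]
    using cardQ by (simp add: measure_pmf_of_set[OF neQ finQ] divide_right_mono)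
  with le show ?thesis by (simp add: G_def)
qed

section \<open>Polynomial lower bound on \<open>omega\<close>\<close>

lemma game_value_repetition_le_omega:
  fixes G :: "('q, nat) game"
  assumes "is_game G" "\<not> trivial_game G"
  shows "game_value (repetition n G) \<le> omega (provers G) (question_alphabet G) (questions G) n"
  unfolding omega_def
proof (rule cSup_upper)
  show "bdd_above {game_value (repetition n H) | H :: ('q, nat) game.
      is_game H \<and> provers H = provers G \<and> question_alphabet H = question_alphabet G \<and>
      questions H = questions G \<and> \<not> trivial_game H}"
    by (rule bdd_aboveI[of _ 1]) (auto intro: game_value_le_1 is_game_repetition)
qed (use assms in blast)

text \<open>The game may change with \<open>n\<close>, since \<open>omega\<close> takes the supremum
  over games separately for each \<open>n\<close>.\<close>

lemma omega_one_hot_ge: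
  assumes r: "r \<ge> 3" and n: "n > 0"
  shows "1 / (real n + 1) ^ r \<le> omega r binary_alphabets (one_hot_questions r) n"
proof -
  obtain S where S: "S \<subseteq> {..<n} \<rightarrow>\<^sub>E {..<r}" "line_free r n S" "r ^ n \<le> (n + 1) ^ r * card S"
    using exists_dense_line_free[of r n] r by auto
  have "real (r ^ n) \<le> real ((n + 1) ^ r * card S)"
    using S(3) by (simp only: of_nat_le_iff)
  then have "1 / (real n + 1) ^ r \<le> real (card S) / real r ^ n"
    using r by (simp add: field_simps)
  also have "\<dots> \<le> game_value (repetition n (line_game r n S))"
    using r n S by (intro game_value_repetition_line_game) auto
  also have "\<dots> \<le> omega r binary_alphabets (one_hot_questions r) n"
    using game_value_repetition_le_omega[of "line_game r n S" n]
      is_game_line_game[of r n S] not_trivial_line_game[OF r n S(1,2)] r n by simp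
  finally show ?thesis .
qed

theorem theorem1p9:
  fixes r :: nat
  assumes "r \<ge> 3"
  shows "\<not> admits_exponential_parallel_repetition r binary_alphabets (one_hot_questions r)"
proof
  assume "admits_exponential_parallel_repetition r binary_alphabets (one_hot_questions r)"
  then obtain C :: real where C: "C < 1"
    and "\<And>n. omega r binary_alphabets (one_hot_questions r) n \<le> C ^ n"
    by (auto simp: admits_exponential_parallel_repetition_def)
  then have bound: "1 / (real n + 1) ^ r \<le> C ^ n" if "n > 0" for n
    using omega_one_hot_ge[OF assms that] order.trans by blast
  \<comment> \<open>The definition only asks for \<open>C < 1\<close>; positivity, used for the
    limit below, comes from the case \<open>n = 1\<close>.\<close>
  have "0 < 1 / (real 1 + 1) ^ r" by simp
  also have "\<dots> \<le> C" using bound[of 1] by simp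
  finally have "C > 0" .
  have "(\<lambda>n. (real n + 1) ^ r * C ^ n) \<longlonglongrightarrow> 0"
    using C \<open>C > 0\<close> by real_asymp
  then have "\<forall>\<^sub>F n in sequentially. (real n + 1) ^ r * C ^ n < 1"
    by (rule order_tendstoD) simp
  \<comment> \<open>The lower bound holds for positive \<open>n\<close>: at \<open>n = 0\<close> the
    line game has empty answer alphabets.\<close>
  then have "\<forall>\<^sub>F n in sequentially. (real n + 1) ^ r * C ^ n < 1 \<and> n > 0"
    using eventually_gt_at_top[of 0] by eventually_elim simp
  then obtain n where "(real n + 1) ^ r * C ^ n < 1" "n > 0"
    using eventually_happens'[OF sequentially_bot] by blast
  then show False using bound[of n] by (simp add: field_simps)
qed

end
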